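(* Let $n,d\geq1$, let $\|\cdot\|$ be any norm on $\mathbb{C}^{n\times n}$, and for $i=1,\dots,n$ let $\eta_i$ be the least positive constant such that $\|A^{(i)}\|_2\leq\eta_i\|A\|$ for all $A\in\mathbb{C}^{n\times n}$, where $A^{(i)}$ is the $i$-th column of $A$ and $\|\cdot\|_2$ is the Euclidean norm of $\mathbb{C}^n$. Set $\eta:=\eta_1\cdots\eta_n$. Let $P(\lambda)=A_0+A_1\lambda+\dots+A_d\lambda^d$ be a matrix polynomial of degree $d$ with $A_j\in\mathbb{C}^{n\times n}$ and $\det A_0\neq0$, let $\zeta_1,\dots,\zeta_{nd}$ be its eigenvalues, arranged by non-decreasing modulus, and let $c=\frac{|\det A_0|}{\|A_0\|^n}$. Let $\alpha_1\leq\dots\leq\alpha_d$ be the tropical roots of $\mathsf{t}p(x)=\max_{0\leq j\leq d}\|A_j\|x^j$, with $\alpha_0=0$, $\alpha_{d+1}=+\infty$; let $k_0=0<k_1<\dots<k_q=d$ be the abscissas of all the vertices of the Newton polygon of $\mathsf{t}p$, and let $\delta_j=\alpha_{k_j}/\alpha_{k_j+1}$ for $j=0,\dots,q$. Denote by $C_{n,d,k}$ the number of maps $\phi:\{1,\dots,n\}\to\{0,\dots,d\}$ such that $\sum_{i=1}^n\phi(i)=k$, so that $C_{n,d,k}\leq(\min(d,k,nd-k)+1)^{n-1}$. Then, for every $j=1,\dots,q$, if $$c_j:=\frac{|\det A_{k_j}|}{\|A_{k_j}\|^n}-(C_{n,d,nk_j}-1)\,\eta\,\delta_j>0,$$ we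 have $$\frac{|\zeta_1\cdots\zeta_{nk_j}|}{(\alpha_1\cdots\alpha_{k_j})^n}\leq\frac{c}{c_j}\binom{nd}{nk_j}.$$
   Context: Degree $d$ means $A_d\neq0$. The eigenvalues of $P$ are the roots of the polynomial $\det P(\lambda)$ counted with multiplicities; if $\det P$ has degree less than $nd$, the list is completed to $nd$ entries by infinite eigenvalues, whose modulus is $+\infty$. The tropical roots of $\mathsf{t}p$ are the unique numbers $0\leq\alpha_1\leq\dots\leq\alpha_d$ such that $\mathsf{t}p(x)=\|A_d\|\prod_{j=1}^d\max(x,\alpha_j)$ for all $x\geq0$. They are all positive when $A_0\neq0$. Ratios with denominator $\alpha_{d+1}=+\infty$ are $0$, so $\delta_0=\delta_q=0$. The Newton polygon of $\mathsf{t}p$ is the graph over $[0,d]$ of the smallest concave function $\geq\log\|A_j\|$ at each integer $j\in\{0,\dots,d\}$ (with $\log0=-\infty$), i.e. the upper boundary of the convex hull of the points $(j,\log\|A_j\|)$; its vertices are its two endpoints and the points where its slope changes. Thus $\alpha_{k_{j-1}+1}=\dots=\alpha_{k_j}<\alpha_{k_j+1}$ for $j=1,\dots,q$. *)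

theory Defs
  imports
    "HOL-Analysis.Analysis"
    "HOL-Computational_Algebra.Polynomial"
begin

text \<open>Norms on the complex vector space of square matrices. They are arbitrary, so they are
  predicates on functions rather than the type class norm.\<close>

definition is_matrix_norm :: "(complex^'n^'n \<Rightarrow> real) \<Rightarrow> bool" where
  "is_matrix_norm N \<longleftrightarrow>
     (\<forall>X. 0 \<le> N X) \<and>
     (\<forall>X. N X = 0 \<longleftrightarrow> X = 0) \<and>
     (\<forall>c X. N (\<chi> i j. c * X $ i $ j) = cmod c * N X) \<and>
     (\<forall>X Y. N (X + Y) \<le> N X + N Y)"

text \<open>The least constant exists because the maximum of the column norm over the compact unit
  sphere of the norm is attained; it is positive because some matrix has a nonzero column.\<close>

definition column_const :: "(complex^'n^'n \<Rightarrow> real) \<Rightarrow> 'n \<Rightarrow> real" where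
  "column_const N i = (LEAST c. c > 0 \<and> (\<forall>X. norm (column i X) \<le> c * N X))"

definition columns_const :: "(complex^'n^'n \<Rightarrow> real) \<Rightarrow> real" where
  "columns_const N = (\<Prod>i\<in>UNIV. column_const N i)"

text \<open>The matrix polynomial with coefficients \<open>A 0, \<dots>, A d\<close> is viewed as a matrix of polynomials;
  values of \<open>A\<close> beyond \<open>d\<close> are irrelevant.\<close>

definition matpoly :: "nat \<Rightarrow> (nat \<Rightarrow> complex^'n^'n) \<Rightarrow> complex poly^'n^'n" where
  "matpoly d A = (\<chi> i j. \<Sum>k\<le>d. monom (A k $ i $ j) k)"

text \<open>\<open>None\<close> stands for the infinite eigenvalue. The multiset has
  \<open>n * d\<close> entries whenever the determinant is a nonzero polynomial.\<close>

definition eigenvalues :: "nat \<Rightarrow> (nat \<Rightarrow> complex^'n^'n) \<Rightarrow> complex option multiset" where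
  "eigenvalues d A =
     image_mset Some (proots (det (matpoly d A))) +
     replicate_mset (CARD('n) * d - degree (det (matpoly d A))) None"

fun modulus :: "complex option \<Rightarrow> ereal" where
  "modulus None = \<infinity>"
| "modulus (Some z) = ereal (cmod z)"

text \<open>In what follows, \<open>a j\<close> plays the role of the norm of the coefficient of index \<open>j\<close>.\<close>

definition tropical_poly :: "nat \<Rightarrow> (nat \<Rightarrow> real) \<Rightarrow> real \<Rightarrow> real" where
  "tropical_poly d a x = Max ((\<lambda>j. a j * x ^ j) ` {0..d})"

text \<open>The numbers \<open>\<alpha> 1, \<dots>, \<alpha> d\<close> are determined by this property.\<close>

definition is_tropical_roots :: "nat \<Rightarrow> (nat \<Rightarrow> real) \<Rightarrow> (nat \<Rightarrow> real) \<Rightarrow> bool" where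
  "is_tropical_roots d a \<alpha> \<longleftrightarrow>
     (\<forall>i\<in>{1..d}. 0 \<le> \<alpha> i) \<and>
     mono_on {1..d} \<alpha> \<and>
     (\<forall>x\<ge>0. tropical_poly d a x = a d * (\<Prod>i=1..d. max x (\<alpha> i)))"

text \<open>The case \<open>m = d\<close> is the convention that \<open>\<alpha> (d + 1)\<close> is infinite.\<close>

definition tropical_ratio :: "nat \<Rightarrow> (nat \<Rightarrow> real) \<Rightarrow> nat \<Rightarrow> real" where
  "tropical_ratio d \<alpha> m = (if m = d then 0 else \<alpha> m / \<alpha> (m + 1))"

text \<open>The smallest concave majorant is the pointwise infimum of all concave majorants. Indices
  with \<open>a j = 0\<close> impose no condition, since the logarithm is then minus infinity. Only the
  values on \<open>{0..real d}\<close> are meaningful.\<close>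

definition newton_polygon :: "nat \<Rightarrow> (nat \<Rightarrow> real) \<Rightarrow> real \<Rightarrow> real" where
  "newton_polygon d a x =
     Inf {g x | g. concave_on {0..real d} g \<and> (\<forall>j\<le>d. a j \<noteq> 0 \<longrightarrow> ln (a j) \<le> g (real j))}"

definition slope_changes_at :: "(real \<Rightarrow> real) \<Rightarrow> real \<Rightarrow> bool" where
  "slope_changes_at f x \<longleftrightarrow>
     (\<exists>s t e. e > 0 \<and> s \<noteq> t \<and>
        (\<forall>h\<in>{0..e}. f (x - h) = f x - s * h \<and> f (x + h) = f x + t * h))"

definition newton_vertices :: "nat \<Rightarrow> (nat \<Rightarrow> real) \<Rightarrow> real set" where
  "newton_vertices d a =
     {0, real d} \<union> {x. 0 < x \<and> x < real d \<and> slope_changes_at (newton_polygon d a) x}"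

definition comp_count :: "nat \<Rightarrow> nat \<Rightarrow> nat \<Rightarrow> nat" where
  "comp_count n d k = card {\<phi> \<in> {1..n} \<rightarrow>\<^sub>E {0..d}. (\<Sum>i=1..n. \<phi> i) = k}"

end

theory Submission
  imports Defs "HOL-Computational_Algebra.Fundamental_Theorem_Algebra"
begin

text \<open>Let \<open>p\<close> be the determinant of the matrix polynomial, \<open>n\<close> the size of the matrices, \<open>D = n * d\<close> and
  \<open>m\<close> the abscissa of a vertex of the Newton polygon. Two estimates of the coefficient of \<open>p\<close> of
  degree \<open>n * m\<close> are compared.

  From above, this coefficient divided by the constant term \<open>det (A 0)\<close> is, up to sign, an elementary symmetric
  function of the reciprocals of the eigenvalues, an infinite eigenvalue having reciprocal zero. It
  has \<open>D choose (n * m)\<close> terms, and none exceeds in modulus the one from the \<open>n * m\<close> smallest eigenvalues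
  (\<open>norm_coeff_le_binomial\<close>).

  From below, multilinearity of the determinant writes the coefficient as a sum over the maps \<open>f\<close>
  assigning to each column the index of the matrix it is taken from, with sum \<open>n * m\<close>
  (\<open>matpoly_det_coeff\<close>). The constant map gives \<open>det (A m)\<close>. By Hadamard's inequality, any other map
  gives at most \<open>columns_const N\<close> times the product of the norms of the matrices \<open>A (f i)\<close>. The Newton
  polygon bounds this product: the norms are bounded by the norm of \<open>A m\<close>, with a factor \<open>\<alpha> m\<close> for each
  step to a smaller index and \<open>1 / \<alpha> (m + 1)\<close> for each step to a larger one. A nonconstant map of mean \<open>m\<close>
  makes equally many steps to both sides, and at least one, which gives the factor
  \<open>\<alpha> m / \<alpha> (m + 1)\<close> (\<open>prod_coeffs_le\<close>).

  The norms of \<open>A 0\<close> and \<open>A m\<close> differ exactly by the factor \<open>\<alpha> 1 * \<dots> * \<alpha> m\<close>, because both indices are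
  vertices of the Newton polygon (\<open>vertex_attained\<close>); this turns the comparison of the two estimates into
  the claim.\<close>

section \<open>Coefficients of a polynomial and its smallest roots\<close>

text \<open>The largest element of a set of \<open>M\<close> positive integers is at least \<open>M\<close>, so its value is at most
  \<open>v M\<close>; the remaining elements are treated by induction.\<close>

lemma prod_le_prod_initial:
  fixes v :: "nat \<Rightarrow> 'a::linordered_idom"
  assumes "antimono_on {1..D} v" "\<And>i. i \<in> {1..D} \<Longrightarrow> 0 \<le> v i"
  shows "S \<subseteq> {1..D} \<Longrightarrow> card S = M \<Longrightarrow> (\<Prod>i\<in>S. v i) \<le> (\<Prod>i=1..M. v i)"
proof (induction M arbitrary: S)
  case 0
  then show ?case using finite_subset[of S "{1..D}"] by auto
next
  case (Suc M)
  have fin: "finite S" using Suc.prems finite_subset[of S "{1..D}"] by auto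
  have ne: "S \<noteq> {}" using Suc.prems by auto
  let ?m = "Max S"
  have mS: "?m \<in> S" using fin ne by simp
  have "S \<subseteq> {1..?m}" using Suc.prems fin by auto
  then have "Suc M \<le> ?m" using card_mono[of "{1..?m}" S] Suc.prems by simp
  moreover have "?m \<le> D" using mS Suc.prems by auto
  ultimately have vm: "v ?m \<le> v (Suc M)" "0 \<le> v ?m"
    using assms by (auto intro: monotone_onD)
  have "(\<Prod>i\<in>S. v i) = (\<Prod>i\<in>S - {?m}. v i) * v ?m"
    using fin mS by (subst prod.remove[of S ?m]) (auto simp: mult.commute)
  also have "\<dots> \<le> (\<Prod>i=1..M. v i) * v (Suc M)"
    using Suc.prems fin mS vm \<open>Suc M \<le> ?m\<close> \<open>?m \<le> D\<close>
    by (intro mult_mono Suc.IH prod_nonneg) (auto intro!: assms(2))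
  finally show ?case by simp
qed

lemma coeff_prod_one_plus:
  fixes u :: "'i \<Rightarrow> 'a::comm_ring_1"
  assumes "finite I"
  shows "coeff (\<Prod>i\<in>I. [:1, u i:]) M = (\<Sum>S | S \<subseteq> I \<and> card S = M. \<Prod>i\<in>S. u i)"
proof -
  have "(\<Prod>i\<in>I. [:1, u i:]) = (\<Prod>i\<in>I. monom (u i) 1 + 1)"
    by (intro prod.cong) (auto simp: monom_Suc monom_0 one_pCons)
  also have "\<dots> = (\<Sum>S\<in>Pow I. \<Prod>i\<in>S. monom (u i) 1)"
    using assms by (simp add: prod_add)
  also have "\<dots> = (\<Sum>S\<in>Pow I. monom (\<Prod>i\<in>S. u i) (card S))"
  proof (intro sum.cong refl)
    fix S assume "S \<in> Pow I"
    then have "finite S" using assms finite_subset by blast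
    then show "(\<Prod>i\<in>S. monom (u i) 1) = monom (\<Prod>i\<in>S. u i) (card S)"
      by (induction S) (auto simp: mult_monom)
  qed
  finally have "coeff (\<Prod>i\<in>I. [:1, u i:]) M = (\<Sum>S\<in>Pow I. if card S = M then \<Prod>i\<in>S. u i else 0)"
    by (simp add: coeff_sum)
  also have "\<dots> = (\<Sum>S | S \<in> Pow I \<and> card S = M. \<Prod>i\<in>S. u i)"
    using assms by (subst sum.inter_filter) auto
  finally show ?thesis by simp
qed

text \<open>Taking reciprocals turns the infinite eigenvalues into zeros, so that all eigenvalues can be
  treated alike.\<close>

fun reciprocal :: "complex option \<Rightarrow> complex" where
  "reciprocal None = 0"
| "reciprocal (Some z) = inverse z"

text \<open>A root \<open>x\<close> contributes the factor \<open>1 - X / x\<close>, and an infinite eigenvalue the factor \<open>1\<close>.\<close>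

lemma poly_eq_prod_reciprocal_roots:
  fixes p :: "complex poly"
  assumes "coeff p 0 \<noteq> 0"
    and "image_mset \<zeta> (mset_set {1..D}) = image_mset Some (proots p) + replicate_mset r None"
  shows "p = smult (coeff p 0) (\<Prod>i\<in>{1..D}. [:1, - reciprocal (\<zeta> i):])"
proof -
  have nz: "x \<noteq> 0" if "x \<in># proots p" for x
    using that assms(1) by (cases "p = 0") (auto simp: poly_0_coeff_0)
  define f where "f = (\<lambda>x. [:1, - reciprocal x:])"
  have "(\<Prod>i\<in>{1..D}. [:1, - reciprocal (\<zeta> i):]) = prod_mset (image_mset f (image_mset \<zeta> (mset_set {1..D})))"
    unfolding f_def by (simp add: prod_unfold_prod_mset image_mset.compositionality o_def)
  also have "\<dots> = (\<Prod>x\<in>#proots p. [:1, - inverse x:])"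
    unfolding assms(2) by (simp add: f_def image_mset.compositionality o_def pCons_one)
  finally have R: "(\<Prod>i\<in>{1..D}. [:1, - reciprocal (\<zeta> i):]) = (\<Prod>x\<in>#proots p. [:1, - inverse x:])" .
  have "(\<Prod>x\<in>#proots p. [:-x, 1:]) = (\<Prod>x\<in>#proots p. [:-x:] * [:1, - inverse x:])"
    using nz by (intro arg_cong[of _ _ prod_mset] image_mset_cong) auto
  also have "\<dots> = [:\<Prod>x\<in>#proots p. -x:] * (\<Prod>x\<in>#proots p. [:1, - inverse x:])"
    by (simp only: prod_mset.distrib prod_mset_const_poly)
  finally have p: "p = smult (lead_coeff p * (\<Prod>x\<in>#proots p. -x)) (\<Prod>x\<in>#proots p. [:1, - inverse x:])"
    (is "p = smult ?c ?Q")
    using complex_poly_decompose_multiset[of p] by simp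
  have "coeff ?Q 0 = 1" unfolding R[symmetric]
    by (simp add: poly_0_coeff_0[symmetric] poly_prod)
  then have "coeff p 0 = ?c" by (subst p) simp
  then show ?thesis unfolding R using p by metis
qed

text \<open>The coefficient of degree \<open>M\<close>, divided by the constant one, is up to sign the elementary symmetric
  function of degree \<open>M\<close> of the reciprocals. It has \<open>D choose M\<close> terms, and the largest one in
  modulus comes from the \<open>M\<close> roots of smallest modulus.\<close>

lemma norm_coeff_le_binomial:
  fixes p :: "complex poly"
  assumes "coeff p 0 \<noteq> 0"
    and "image_mset \<zeta> (mset_set {1..D}) = image_mset Some (proots p) + replicate_mset r None"
    and mono: "mono_on {1..D} (\<lambda>i. modulus (\<zeta> i))"
  shows "cmod (coeff p M) \<le> cmod (coeff p 0) * real (D choose M) * (\<Prod>i=1..M. cmod (reciprocal (\<zeta> i)))"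
proof -
  have nz: "\<zeta> i \<noteq> Some 0" if "i \<in> {1..D}" for i
  proof
    assume "\<zeta> i = Some 0"
    then have "Some 0 \<in># image_mset \<zeta> (mset_set {1..D})" using that by force
    then have "0 \<in># proots p" unfolding assms(2) by (auto split: if_splits)
    then show False using assms(1) by (cases "p = 0") (auto simp: poly_0_coeff_0)
  qed
  have anti: "antimono_on {1..D} (\<lambda>i. cmod (reciprocal (\<zeta> i)))"
  proof (rule monotone_onI)
    fix i j assume ij: "i \<in> {1..D}" "j \<in> {1..D}" "i \<le> j"
    have "modulus (\<zeta> i) \<le> modulus (\<zeta> j)" using monotone_onD[OF mono] ij by blast
    then show "cmod (reciprocal (\<zeta> i)) \<ge> cmod (reciprocal (\<zeta> j))"
      using nz[OF ij(1)] nz[OF ij(2)]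
      by (cases "\<zeta> i"; cases "\<zeta> j") (auto simp: norm_inverse intro!: le_imp_inverse_le)
  qed
  have "cmod (coeff p M) = cmod (coeff p 0) *
      cmod (\<Sum>S | S \<subseteq> {1..D} \<and> card S = M. \<Prod>i\<in>S. - reciprocal (\<zeta> i))"
    by (subst poly_eq_prod_reciprocal_roots[OF assms(1,2)])
       (simp only: coeff_smult norm_mult coeff_prod_one_plus finite_atLeastAtMost)
  also have "\<dots> \<le> cmod (coeff p 0) *
      (\<Sum>S | S \<subseteq> {1..D} \<and> card S = M. \<Prod>i=1..M. cmod (reciprocal (\<zeta> i)))"
    using prod_le_prod_initial[OF anti]
    by (intro mult_left_mono sum_norm_le) (auto simp: prod_norm[symmetric])
  also have "\<dots> = cmod (coeff p 0) * real (D choose M) * (\<Prod>i=1..M. cmod (reciprocal (\<zeta> i)))"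
    by (simp add: n_subsets)
  finally show ?thesis .
qed

section \<open>Counting maps with a prescribed sum\<close>

text \<open>All values but the last determine the last one, because the sum is prescribed, and none of them
  exceeds \<open>d\<close> or the sum \<open>m\<close>.\<close>

lemma comp_count_le_left:
  assumes "n \<ge> 1"
  shows "comp_count n d m \<le> (min d m + 1) ^ (n - 1)"
proof -
  let ?A = "{\<phi> \<in> {1..n} \<rightarrow>\<^sub>E {0..d}. (\<Sum>i=1..n. \<phi> i) = m}"
  have split: "(\<Sum>i=1..n. \<phi> i) = (\<Sum>i=1..n-1. \<phi> i) + \<phi> n" for \<phi> :: "nat \<Rightarrow> nat"
    using assms by (cases n) auto
  have "inj_on (\<lambda>\<phi>. restrict \<phi> {1..n-1}) ?A"
  proof (rule inj_onI)
    fix \<phi> \<psi> assume A: "\<phi> \<in> ?A" "\<psi> \<in> ?A" and eq: "restrict \<phi> {1..n-1} = restrict \<psi> {1..n-1}"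
    have e: "\<phi> i = \<psi> i" if "i \<in> {1..n-1}" for i using fun_cong[OF eq, of i] that by simp
    then have "(\<Sum>i=1..n-1. \<phi> i) = (\<Sum>i=1..n-1. \<psi> i)" by simp
    then have "\<phi> n = \<psi> n" using A split[of \<phi>] split[of \<psi>] by auto
    with e have eq': "\<phi> i = \<psi> i" if "i \<in> {1..n}" for i
      using that by (cases "i = n") auto
    show "\<phi> = \<psi>" by (rule PiE_ext[of \<phi> "{1..n}" "\<lambda>_. {0..d}" \<psi>]) (use A eq' in auto)
  qed
  moreover have "(\<lambda>\<phi>. restrict \<phi> {1..n-1}) ` ?A \<subseteq> {1..n-1} \<rightarrow>\<^sub>E {0..min d m}"
  proof (rule image_subsetI)
    fix \<phi> assume \<phi>: "\<phi> \<in> ?A"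
    have "\<phi> i \<in> {0..min d m}" if "i \<in> {1..n-1}" for i
    proof -
      have i: "i \<in> {1..n}" using that by auto
      then have "\<phi> i \<le> (\<Sum>i=1..n. \<phi> i)" by (intro member_le_sum) auto
      then show ?thesis using \<phi> PiE_mem[of \<phi> "{1..n}" "\<lambda>_. {0..d}" i] i by auto
    qed
    then show "restrict \<phi> {1..n-1} \<in> {1..n-1} \<rightarrow>\<^sub>E {0..min d m}"
      unfolding restrict_PiE_iff by blast
  qed
  ultimately have "card ?A \<le> card ({1..n-1} \<rightarrow>\<^sub>E {0..min d m})"
    by (intro card_inj_on_le) (auto intro: finite_PiE)
  then show ?thesis by (simp add: comp_count_def card_PiE)
qed

text \<open>The bijection replaces every value \<open>\<phi> i\<close> by \<open>d - \<phi> i\<close>.\<close>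

lemma comp_count_reflect:
  assumes "m \<le> n * d"
  shows "comp_count n d m = comp_count n d (n * d - m)"
proof -
  let ?A = "\<lambda>m. {\<phi> \<in> {1..n} \<rightarrow>\<^sub>E {0..d}. (\<Sum>i=1..n. \<phi> i) = m}"
  let ?r = "\<lambda>\<phi>. restrict (\<lambda>i. d - \<phi> i) {1..n}"
  have sum: "(\<Sum>i=1..n. d - \<phi> i) = n * d - (\<Sum>i=1..n. \<phi> i)"
    if "\<phi> \<in> {1..n} \<rightarrow>\<^sub>E {0..d}" for \<phi> :: "nat \<Rightarrow> nat"
    using that by (subst sum_subtractf_nat) (auto dest: PiE_mem)
  have inv: "?r (?r \<phi>) = \<phi>" if "\<phi> \<in> {1..n} \<rightarrow>\<^sub>E {0..d}" for \<phi> :: "nat \<Rightarrow> nat"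
    using that by (intro PiE_ext[of _ "{1..n}" "\<lambda>_. {0..d}"]) (auto dest: PiE_mem)
  have "bij_betw ?r (?A m) (?A (n * d - m))"
    using assms inv
    by (intro bij_betwI[of _ _ _ ?r]) (auto simp: sum[simplified])
  then show ?thesis unfolding comp_count_def by (rule bij_betw_same_card)
qed

lemma comp_count_le:
  assumes "n \<ge> 1" "m \<le> n * d"
  shows "comp_count n d m \<le> (min (min d m) (n * d - m) + 1) ^ (n - 1)"
  using comp_count_le_left[OF assms(1), of d m] comp_count_le_left[OF assms(1), of d "n * d - m"]
    comp_count_reflect[OF assms(2)]
  by (auto simp: min_def)

text \<open>The columns of a matrix are indexed by the type \<open>'n\<close>, whereas the counting function uses
  \<open>{1..n}\<close>; an enumeration of the type carries one to the other.\<close>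

lemma card_functions_with_sum:
  "card {f :: 'n::finite \<Rightarrow> nat. (\<forall>i. f i \<le> d) \<and> (\<Sum>i\<in>UNIV. f i) = m} = comp_count CARD('n) d m"
proof -
  obtain h where h: "bij_betw h {1..CARD('n)} (UNIV :: 'n set)"
    using finite_same_card_bij[of "{1..CARD('n)}" "UNIV :: 'n set"] by auto
  let ?g = "inv_into {1..CARD('n)} h"
  have g: "bij_betw ?g UNIV {1..CARD('n)}" using h by (rule bij_betw_inv_into)
  have hg: "h (?g i) = i" "?g i \<in> {1..CARD('n)}" for i
    using h g by (auto simp: bij_betw_inv_into_right bij_betw_def)
  have gh: "?g (h i) = i" if "i \<in> {1..CARD('n)}" for i
    using h that by (simp add: bij_betw_inv_into_left)
  have sum: "(\<Sum>i=1..CARD('n). f (h i)) = (\<Sum>i\<in>UNIV. f i)" for f :: "'n \<Rightarrow> nat"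
    using h by (rule sum.reindex_bij_betw)
  have sum': "(\<Sum>i\<in>UNIV. \<phi> (?g i)) = (\<Sum>i=1..CARD('n). \<phi> i)" for \<phi> :: "nat \<Rightarrow> nat"
    using g by (rule sum.reindex_bij_betw)
  have "bij_betw (\<lambda>f. restrict (f \<circ> h) {1..CARD('n)})
      {f :: 'n \<Rightarrow> nat. (\<forall>i. f i \<le> d) \<and> (\<Sum>i\<in>UNIV. f i) = m}
      {\<phi> \<in> {1..CARD('n)} \<rightarrow>\<^sub>E {0..d}. (\<Sum>i=1..CARD('n). \<phi> i) = m}"
  proof (rule bij_betwI[of _ _ _ "\<lambda>\<phi>. \<phi> \<circ> ?g"], goal_cases)
    case 1 then show ?case by (auto simp: sum[simplified])
  next
    case 2 then show ?case using hg by (fastforce simp: sum'[simplified] dest: PiE_mem)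
  next
    case (3 f) then show ?case using hg by (auto simp: fun_eq_iff)
  next
    case (4 \<phi>) then show ?case
      by (intro PiE_ext[of _ "{1..CARD('n)}" "\<lambda>_. {0..d}"])
         (use gh hg in \<open>auto dest: PiE_mem\<close>)
  qed
  then show ?thesis unfolding comp_count_def by (rule bij_betw_same_card)
qed

section \<open>Column constants of a matrix norm and Hadamard's inequality\<close>

text \<open>This is one half of the equivalence of norms in finite dimension. Convexity makes \<open>F\<close>
  continuous, so it attains a minimum on the unit sphere, which is positive by definiteness.\<close>

lemma norm_le_mult_of_norm_axioms:
  fixes F :: "'a::euclidean_space \<Rightarrow> real"
  assumes nonneg: "\<And>x. 0 \<le> F x" and zero: "\<And>x. F x = 0 \<longleftrightarrow> x = 0"
    and scale: "\<And>r x. F (r *\<^sub>R x) = \<bar>r\<bar> * F x" and tri: "\<And>x y. F (x + y) \<le> F x + F y"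
  obtains K where "K > 0" "\<And>x. norm x \<le> K * F x"
proof -
  have "convex_on UNIV F"
  proof (rule convex_onI)
    fix t :: real and x y assume "0 < t" "t < 1"
    then show "F ((1 - t) *\<^sub>R x + t *\<^sub>R y) \<le> (1 - t) * F x + t * F y"
      using tri[of "(1 - t) *\<^sub>R x" "t *\<^sub>R y"] by (simp add: scale)
  qed simp
  then have "continuous_on UNIV F" by (rule convex_on_continuous[OF open_UNIV])
  then have "continuous_on (sphere 0 1) F" by (rule continuous_on_subset) simp
  then obtain z :: 'a where z: "z \<in> sphere 0 1" "\<And>x. x \<in> sphere 0 1 \<Longrightarrow> F z \<le> F x"
    using continuous_attains_inf[of "sphere (0::'a) 1" F] by (auto simp: sphere_eq_empty)
  then have pos: "F z > 0" using nonneg[of z] zero[of z] by fastforce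
  show thesis
  proof (rule that[of "1 / F z"])
    fix x :: 'a
    show "norm x \<le> 1 / F z * F x"
    proof (cases "x = 0")
      case False
      then have "F z \<le> F ((1 / norm x) *\<^sub>R x)" by (intro z(2)) simp
      then have "F z \<le> F x / norm x" by (simp only: scale) simp
      then have "F z * norm x \<le> F x" using False by (simp add: pos_le_divide_eq)
      then show ?thesis using pos by (simp add: field_simps)
    qed (use pos nonneg in simp)
  qed (use pos in simp)
qed

lemma norm_column_le:
  fixes X :: "complex^'n^'n"
  shows "norm (column i X) \<le> norm X"
proof -
  have "norm (column i X) \<le> norm (\<chi> j. norm (X $ j))"
    by (rule norm_le_componentwise_cart) (simp add: column_def Finite_Cartesian_Product.norm_nth_le)
  then show ?thesis by (simp add: norm_vec_def L2_set_def)
qed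

text \<open>The least constant is the supremum of the ratio of the two sides. The supremum is finite by the
  equivalence of norms, and it is positive because the identity matrix has no zero column.\<close>

lemma column_const_attained:
  fixes N :: "complex^'n^'n \<Rightarrow> real"
  assumes "is_matrix_norm N"
  shows "column_const N i > 0" "norm (column i X) \<le> column_const N i * N X"
proof -
  have nonneg: "0 \<le> N X" and zero: "N X = 0 \<longleftrightarrow> X = 0"
    and tri: "N (X + Y) \<le> N X + N Y" and sc: "N (\<chi> i j. c * X $ i $ j) = cmod c * N X" for X Y c
    using assms unfolding is_matrix_norm_def by blast+
  have scale: "N (r *\<^sub>R X) = \<bar>r\<bar> * N X" for r X
  proof -
    have "r *\<^sub>R X = (\<chi> i j. of_real r * X $ i $ j)" by (simp add: vec_eq_iff scaleR_conv_of_real[where 'a = complex])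
    then show ?thesis using sc[of "of_real r" X] by simp
  qed
  obtain K where K: "K > 0" "\<And>X. norm X \<le> K * N X"
    using norm_le_mult_of_norm_axioms[of N] nonneg zero scale tri by blast
  define S where "S = {norm (column i X) / N X | X. X \<noteq> 0}"
  have Npos: "N X > 0" if "X \<noteq> 0" for X using that nonneg[of X] zero[of X] by linarith
  have "norm (column i X) / N X \<le> K" if "X \<noteq> 0" for X
    using Npos[OF that] order_trans[OF norm_column_le K(2), of i X] by (simp add: pos_divide_le_eq)
  then have bdd: "bdd_above S" unfolding S_def by (intro bdd_aboveI[of _ K]) auto
  have in_S: "norm (column i X) / N X \<in> S" if "X \<noteq> 0" for X using that unfolding S_def by blast
  have one: "(mat 1 :: complex^'n^'n) \<noteq> 0" by (auto simp: vec_eq_iff mat_def)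
  have "column i (mat 1 :: complex^'n^'n) \<noteq> 0" by (auto simp: vec_eq_iff mat_def column_def)
  then have "0 < norm (column i (mat 1 :: complex^'n^'n)) / N (mat 1)" using Npos[OF one] by simp
  also have "\<dots> \<le> Sup S" using in_S[OF one] bdd by (rule cSup_upper)
  finally have pos: "Sup S > 0" .
  have le: "norm (column i X) \<le> Sup S * N X" for X
  proof (cases "X = 0")
    case False
    then show ?thesis using cSup_upper[OF in_S[OF False] bdd] Npos[OF False] by (simp add: pos_divide_le_eq)
  next
    case True
    then have "N X = 0" "column i X = 0" using zero[of X] by (simp_all add: column_def vec_eq_iff)
    then show ?thesis by simp
  qed
  have "column_const N i = Sup S"
    unfolding column_const_def
  proof (rule Least_equality)
    fix c assume c: "c > 0 \<and> (\<forall>X. norm (column i X) \<le> c * N X)"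
    show "Sup S \<le> c"
    proof (rule cSup_least)
      show "S \<noteq> {}" using in_S[OF one] by blast
      show "x \<le> c" if "x \<in> S" for x using that c Npos unfolding S_def by (auto simp: pos_divide_le_eq)
    qed
  qed (use pos le in blast)
  then show "column_const N i > 0" "norm (column i X) \<le> column_const N i * N X" using pos le by auto
qed

definition cdot :: "complex^'n \<Rightarrow> complex^'n \<Rightarrow> complex" where
  "cdot x y = (\<Sum>k\<in>UNIV. x $ k * cnj (y $ k))"

lemma cdot_self: "cdot x x = of_real ((norm x)\<^sup>2)"
  by (simp add: cdot_def norm_vec_def L2_set_def sum_nonneg complex_mult_cnj cmod_power2)

lemma cdot_diff_left: "cdot (x - y) z = cdot x z - cdot y z"
  by (simp add: cdot_def algebra_simps sum_subtractf)

lemma cdot_sum_left: "cdot (\<Sum>j\<in>S. c j *s r j) z = (\<Sum>j\<in>S. c j * cdot (r j) z)"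
  unfolding cdot_def sum_component
  by (simp add: sum_distrib_right sum_distrib_left mult.assoc) (rule sum.swap)

lemma cdot_commute: "cdot y x = cnj (cdot x y)"
  by (simp add: cdot_def mult.commute)

lemma norm_add_orthogonal:
  assumes "cdot x y = 0"
  shows "(norm (x + y))\<^sup>2 = (norm x)\<^sup>2 + (norm y)\<^sup>2"
proof -
  have "cdot (x + y) (x + y) = cdot x x + cdot y y + cdot x y + cdot y x"
    by (simp add: cdot_def algebra_simps sum.distrib)
  also have "\<dots> = cdot x x + cdot y y" using assms cdot_commute[of y x] by simp
  finally show ?thesis unfolding cdot_self of_real_add[symmetric] of_real_eq_iff .
qed

text \<open>This is the Gram-Schmidt process without normalization: subtracting from a row a combination of
  the others keeps the determinant, and subtracting the orthogonal projection onto the span of rows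
  that are already orthogonal shortens the row.\<close>

lemma orthogonalize_rows:
  fixes M :: "complex^'n^'n"
  assumes "finite S"
  shows "\<exists>M'. det M' = det M \<and> (\<forall>i\<in>S. \<forall>j\<in>S. i \<noteq> j \<longrightarrow> cdot (M' $ i) (M' $ j) = 0) \<and>
    (\<forall>i. norm (M' $ i) \<le> norm (M $ i))"
  using assms
proof (induction S)
  case empty
  then show ?case by auto
next
  case (insert i S)
  then obtain M' where M': "det M' = det M"
    "\<And>i j. i \<in> S \<Longrightarrow> j \<in> S \<Longrightarrow> i \<noteq> j \<Longrightarrow> cdot (M' $ i) (M' $ j) = 0"
    "\<And>i. norm (M' $ i) \<le> norm (M $ i)" by blast
  \<comment> \<open>If row \<open>j\<close> is zero, then \<open>c j = 0\<close> by the convention on division by zero.\<close>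
  define c where "c j = cdot (M' $ i) (M' $ j) / cdot (M' $ j) (M' $ j)" for j
  define p where "p = (\<Sum>j\<in>S. c j *s M' $ j)"
  define x where "x = M' $ i - p"
  define M'' where "M'' = (\<chi> k. if k = i then x else M' $ k)"
  have orth: "cdot x (M' $ j) = 0" if j: "j \<in> S" for j
  proof -
    have "cdot p (M' $ j) = (\<Sum>l\<in>S. c l * cdot (M' $ l) (M' $ j))"
      unfolding p_def by (rule cdot_sum_left)
    also have "\<dots> = (\<Sum>l\<in>S. if l = j then c j * cdot (M' $ j) (M' $ j) else 0)"
      using M'(2) j by (intro sum.cong) auto
    also have "\<dots> = cdot (M' $ i) (M' $ j)"
    proof (cases "M' $ j = 0")
      case True
      then show ?thesis by (simp add: cdot_def)
    next
      case False
      then show ?thesis using j insert.hyps by (simp add: c_def cdot_self)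
    qed
    finally show ?thesis by (simp add: x_def cdot_diff_left)
  qed
  have orth': "cdot (M' $ j) x = 0" if "j \<in> S" for j
    using orth[OF that] cdot_commute[of "M' $ j" x] by simp
  have "cdot p x = 0" unfolding p_def cdot_sum_left using orth' by simp
  then have "cdot x p = 0" using cdot_commute[of x p] by simp
  then have "(norm (M' $ i))\<^sup>2 = (norm x)\<^sup>2 + (norm p)\<^sup>2"
    using norm_add_orthogonal[of x p] by (simp add: x_def)
  then have "(norm x)\<^sup>2 \<le> (norm (M' $ i))\<^sup>2" by simp
  then have "norm x \<le> norm (M' $ i)" by (rule power2_le_imp_le) simp
  moreover have "det M'' = det M'"
  proof -
    have "- p \<in> vec.span {row j M' |j. j \<noteq> i}"
      unfolding p_def using insert.hyps
      by (intro vec.span_neg vec.span_sum vec.span_scale vec.span_base) (auto simp: row_def)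
    note span = this
    have row: "row k M' = M' $ k" for k by (simp add: row_def vec_eq_iff)
    show ?thesis
      using det_row_span[OF span] unfolding row M''_def x_def diff_conv_add_uminus .
  qed
  ultimately show ?case
    using M' orth orth' insert.hyps order_trans[OF _ M'(3), of "norm x" i]
    by (intro exI[of _ M'']) (auto simp: M''_def)
qed

text \<open>With orthogonal rows, the product of the matrix and its adjoint is diagonal with the squared row
  lengths on the diagonal, so equality holds; orthogonalizing the rows only shortens them.\<close>

theorem hadamard_inequality_rows:
  fixes M :: "complex^'n^'n"
  shows "cmod (det M) \<le> (\<Prod>i\<in>UNIV. norm (M $ i))"
proof -
  obtain M' where M': "det M' = det M" "\<And>i j. i \<noteq> j \<Longrightarrow> cdot (M' $ i) (M' $ j) = 0"
    "\<And>i. norm (M' $ i) \<le> norm (M $ i)"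
    using orthogonalize_rows[of UNIV M] by auto
  define C where "C = (\<chi> i j. cnj (M' $ j $ i))"
  have "det C = cnj (det M')"
  proof -
    have "det C = det (transpose C)" by simp
    also have "\<dots> = cnj (det M')" by (simp add: det_def C_def transpose_def)
    finally show ?thesis .
  qed
  moreover have "(M' ** C) $ i $ j = cdot (M' $ i) (M' $ j)" for i j
    by (simp add: matrix_matrix_mult_def C_def cdot_def)
  then have "det (M' ** C) = (\<Prod>i\<in>UNIV. of_real ((norm (M' $ i))\<^sup>2))"
    using M'(2) by (subst det_diagonal) (auto simp: cdot_self)
  ultimately have "det M' * cnj (det M') = of_real ((\<Prod>i\<in>UNIV. norm (M' $ i))\<^sup>2)"
    by (simp add: det_mul prod_power_distrib)
  then have "(cmod (det M'))\<^sup>2 = (\<Prod>i\<in>UNIV. norm (M' $ i))\<^sup>2"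
    unfolding complex_norm_square[symmetric] of_real_eq_iff .
  then have "cmod (det M') = (\<Prod>i\<in>UNIV. norm (M' $ i))"
    by (simp add: prod_nonneg)
  also have "\<dots> \<le> (\<Prod>i\<in>UNIV. norm (M $ i))" using M'(3) by (intro prod_mono) auto
  finally show ?thesis by (simp add: M'(1))
qed

corollary hadamard_inequality_columns:
  fixes M :: "complex^'n^'n"
  shows "cmod (det M) \<le> (\<Prod>i\<in>UNIV. norm (column i M))"
proof -
  have "transpose M $ i = column i M" for i by (simp add: transpose_def column_def vec_eq_iff)
  then show ?thesis using hadamard_inequality_rows[of "transpose M"] by simp
qed

section \<open>The determinant of a matrix polynomial\<close>

text \<open>The determinant is linear in each column, and the column \<open>i\<close> of the matrix polynomial is a sum over
  the exponents \<open>k\<close>. Choosing one exponent \<open>f i\<close> per column gives a term of degree \<open>\<Sum>i. f i\<close>.\<close>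

lemma matpoly_det_coeff:
  fixes A :: "nat \<Rightarrow> complex^'n^'n"
  shows "coeff (det (matpoly d A)) m =
    (\<Sum>f | (\<forall>i. f i \<le> d) \<and> (\<Sum>i\<in>UNIV. f i) = m. det (\<chi> r i. A (f i) $ r $ i))"
proof -
  let ?F = "{f :: 'n \<Rightarrow> nat. \<forall>i. f i \<le> d}"
  let ?P = "{\<sigma>. \<sigma> permutes (UNIV :: 'n set)}"
  have PiE: "PiE (UNIV :: 'n set) (\<lambda>_. {..d}) = ?F" by (auto simp: PiE_UNIV_domain Pi_def)
  have "finite (PiE (UNIV :: 'n set) (\<lambda>_. {..d}))" by (rule finite_PiE) auto
  then have fin: "finite ?F" unfolding PiE .
  have of_int: "coeff (of_int z * q) m = of_int z * coeff q m" for z and q :: "complex poly"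
    by (simp add: of_int_poly)
  have "det (matpoly d A) = det (transpose (matpoly d A))" by simp
  also have "\<dots> = (\<Sum>\<sigma>\<in>?P. of_int (sign \<sigma>) * (\<Prod>i\<in>UNIV. \<Sum>k\<le>d. monom (A k $ \<sigma> i $ i) k))"
    by (simp add: det_def transpose_def matpoly_def)
  also have "\<dots> = (\<Sum>\<sigma>\<in>?P. of_int (sign \<sigma>) * (\<Sum>f\<in>?F. \<Prod>i\<in>UNIV. monom (A (f i) $ \<sigma> i $ i) (f i)))"
    by (subst prod_sum_PiE) (auto simp: PiE)
  also have "\<dots> = (\<Sum>\<sigma>\<in>?P. of_int (sign \<sigma>) * (\<Sum>f\<in>?F. monom (\<Prod>i\<in>UNIV. A (f i) $ \<sigma> i $ i) (\<Sum>i\<in>UNIV. f i)))"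
  proof -
    have "(\<Prod>i\<in>I. monom (c i) (f i)) = monom (\<Prod>i\<in>I. c i) (\<Sum>i\<in>I. f i)"
      for I :: "'n set" and c :: "'n \<Rightarrow> complex" and f :: "'n \<Rightarrow> nat"
      by (induction I rule: infinite_finite_induct) (auto simp: mult_monom)
    then show ?thesis by simp
  qed
  finally have "coeff (det (matpoly d A)) m = (\<Sum>\<sigma>\<in>?P. of_int (sign \<sigma>) *
      (\<Sum>f\<in>?F. if (\<Sum>i\<in>UNIV. f i) = m then \<Prod>i\<in>UNIV. A (f i) $ \<sigma> i $ i else 0))"
    by (simp add: coeff_sum of_int)
  also have "\<dots> = (\<Sum>\<sigma>\<in>?P. \<Sum>f | f \<in> ?F \<and> (\<Sum>i\<in>UNIV. f i) = m.
      of_int (sign \<sigma>) * (\<Prod>i\<in>UNIV. A (f i) $ \<sigma> i $ i))"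
    by (simp only: sum.inter_filter[OF fin, symmetric] sum_distrib_left mem_Collect_eq)
  also have "\<dots> = (\<Sum>f | f \<in> ?F \<and> (\<Sum>i\<in>UNIV. f i) = m.
      det (transpose (\<chi> r i. A (f i) $ r $ i)))"
    by (subst sum.swap) (simp add: det_def transpose_def)
  finally show ?thesis by simp
qed

lemma matpoly_det_coeff_0:
  fixes A :: "nat \<Rightarrow> complex^'n^'n"
  shows "coeff (det (matpoly d A)) 0 = det (A 0)"
proof -
  have "{f :: 'n \<Rightarrow> nat. (\<forall>i. f i \<le> d) \<and> (\<Sum>i\<in>UNIV. f i) = 0} = {\<lambda>_. 0}"
    by (auto simp: fun_eq_iff)
  then show ?thesis unfolding matpoly_det_coeff by simp
qed

section \<open>Tropical roots and the Newton polygon\<close>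

locale tropical =
  fixes d :: nat and a \<alpha> :: "nat \<Rightarrow> real"
  assumes roots: "is_tropical_roots d a \<alpha>"
    and a_nonneg: "\<And>j. 0 \<le> a j" and a_0: "a 0 \<noteq> 0" and a_d: "a d \<noteq> 0"
begin

text \<open>These are the largest coefficients with the same tropical polynomial; their logarithms are the
  heights of the Newton polygon at the integers.\<close>

definition polygon_coeff :: "nat \<Rightarrow> real" where "polygon_coeff j = a d * (\<Prod>i=j+1..d. \<alpha> i)"

lemma root_nonneg: "i \<in> {1..d} \<Longrightarrow> 0 \<le> \<alpha> i"
  and root_mono: "i \<in> {1..d} \<Longrightarrow> j \<in> {1..d} \<Longrightarrow> i \<le> j \<Longrightarrow> \<alpha> i \<le> \<alpha> j"
  and tropical_poly_factored: "0 \<le> x \<Longrightarrow> tropical_poly d a x = a d * (\<Prod>i=1..d. max x (\<alpha> i))"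
  using roots unfolding is_tropical_roots_def by (auto intro: mono_onD)

lemma term_le: "j \<le> d \<Longrightarrow> a j * x ^ j \<le> tropical_poly d a x"
  unfolding tropical_poly_def by (intro Max_ge) auto

lemma term_attains: "\<exists>j\<le>d. a j * x ^ j = tropical_poly d a x"
proof -
  have "tropical_poly d a x \<in> (\<lambda>j. a j * x ^ j) ` {0..d}"
    unfolding tropical_poly_def by (intro Max_in) auto
  then show ?thesis by force
qed

text \<open>If \<open>x\<close> separates the first \<open>i\<close> roots from the others, then the maxima in the factorization are
  \<open>x\<close> for the former and the roots themselves for the latter.\<close>

lemma tropical_poly_between:
  assumes "i \<le> d" "0 \<le> x" "\<And>l. l \<in> {1..i} \<Longrightarrow> \<alpha> l \<le> x" "\<And>l. l \<in> {i+1..d} \<Longrightarrow> x \<le> \<alpha> l"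
  shows "tropical_poly d a x = polygon_coeff i * x ^ i"
proof -
  have "{1..d} = {1..i} \<union> {i+1..d}" using assms(1) by auto
  then have "(\<Prod>l=1..d. max x (\<alpha> l)) = (\<Prod>l=1..i. max x (\<alpha> l)) * (\<Prod>l=i+1..d. max x (\<alpha> l))"
    by (simp add: prod.union_disjoint)
  also have "(\<Prod>l=1..i. max x (\<alpha> l)) = (\<Prod>l=1..i. x)"
    using assms(3) by (intro prod.cong) auto
  also have "(\<Prod>l=i+1..d. max x (\<alpha> l)) = (\<Prod>l=i+1..d. \<alpha> l)"
    using assms(4) by (intro prod.cong) auto
  finally show ?thesis using tropical_poly_factored[OF assms(2)] by (simp add: polygon_coeff_def)
qed

lemma coeff_d_attained: "polygon_coeff d = a d" by (simp add: polygon_coeff_def)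

lemma coeff_0_attained: "a 0 = polygon_coeff 0"
proof -
  obtain j where j: "j \<le> d" "a j * 0 ^ j = tropical_poly d a 0" using term_attains by blast
  have t: "tropical_poly d a 0 = polygon_coeff 0"
    using tropical_poly_between[of 0 0] root_nonneg by simp
  have "a 0 \<le> polygon_coeff 0" using term_le[of 0 0] t by simp
  moreover have "0 < polygon_coeff 0" using calculation a_nonneg[of 0] a_0 by simp
  ultimately show ?thesis using j t by (cases "j = 0") (auto simp: power_0_left)
qed

lemma root_pos:
  assumes "i \<in> {1..d}"
  shows "0 < \<alpha> i"
proof -
  have "(\<Prod>i=1..d. \<alpha> i) \<noteq> 0" using coeff_0_attained a_0 by (auto simp: polygon_coeff_def)
  then have "\<alpha> i \<noteq> 0" using assms by (auto simp: prod_zero_iff)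
  then show ?thesis using root_nonneg[OF assms] by simp
qed

lemma a_d_pos: "0 < a d" using a_d a_nonneg[of d] by simp

lemma polygon_coeff_pos: "j \<le> d \<Longrightarrow> 0 < polygon_coeff j"
  unfolding polygon_coeff_def using a_d_pos root_pos by (auto intro!: mult_pos_pos prod_pos)

text \<open>At the point \<open>\<alpha> j\<close> the term of index \<open>j\<close> is at most the tropical polynomial, which equals
  \<open>polygon_coeff j * \<alpha> j ^ j\<close> there.\<close>

lemma coeff_le_polygon_coeff:
  assumes "j \<le> d"
  shows "a j \<le> polygon_coeff j"
proof (cases "j = 0")
  case True
  then show ?thesis using coeff_0_attained by simp
next
  case False
  then have pos: "0 < \<alpha> j" using root_pos assms by simp
  have "tropical_poly d a (\<alpha> j) = polygon_coeff j * \<alpha> j ^ j"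
    using assms False pos by (intro tropical_poly_between) (auto intro!: root_mono)
  then have "a j * \<alpha> j ^ j \<le> polygon_coeff j * \<alpha> j ^ j" using term_le[OF assms, of "\<alpha> j"] by simp
  then show ?thesis using pos by simp
qed

lemma polygon_coeff_split: "i \<le> j \<Longrightarrow> j \<le> d \<Longrightarrow> polygon_coeff i = polygon_coeff j * (\<Prod>l=i+1..j. \<alpha> l)"
proof -
  assume "i \<le> j" "j \<le> d"
  then have "{i+1..d} = {i+1..j} \<union> {j+1..d}" by auto
  then show ?thesis unfolding polygon_coeff_def by (simp add: prod.union_disjoint)
qed

text \<open>Strictly between two distinct consecutive roots, only the term of index \<open>i\<close> can reach the
  tropical polynomial, since every other term is strictly smaller even with the largest possible
  coefficient.\<close>

lemma corner_attained:
  assumes "1 \<le> i" "i < d" "\<alpha> i < \<alpha> (i + 1)"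
  shows "a i = polygon_coeff i"
proof -
  obtain x where x: "\<alpha> i < x" "x < \<alpha> (i + 1)" using assms(3) dense by blast
  have xpos: "0 < x" using x root_pos[of i] assms by simp
  have below: "\<alpha> l < x" if "l \<in> {1..i}" for l using root_mono[of l i] that assms x by fastforce
  have above: "x < \<alpha> l" if "l \<in> {i+1..d}" for l using root_mono[of "i+1" l] that assms x by fastforce
  have t: "tropical_poly d a x = polygon_coeff i * x ^ i"
    using assms xpos below above by (intro tropical_poly_between) (auto intro: less_imp_le)
  obtain j where j: "j \<le> d" "a j * x ^ j = polygon_coeff i * x ^ i" using term_attains[of x] t by auto
  have "j = i"
  proof (rule ccontr)
    assume "j \<noteq> i"
    then consider "j < i" | "i < j" by linarith
    then have "polygon_coeff j * x ^ j < polygon_coeff i * x ^ i"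
    proof cases
      case 1
      have "(\<Prod>l=j+1..i. \<alpha> l) < (\<Prod>l=j+1..i. x)"
        using 1 below root_pos assms xpos by (intro prod_mono_strict) (auto intro: less_imp_le)
      then have "(\<Prod>l=j+1..i. \<alpha> l) < x ^ (i - j)" by simp
      moreover have "polygon_coeff j = polygon_coeff i * (\<Prod>l=j+1..i. \<alpha> l)" using polygon_coeff_split[of j i] 1 assms by simp
      ultimately have "polygon_coeff j * x ^ j < polygon_coeff i * x ^ (i - j) * x ^ j" using polygon_coeff_pos[of i] assms xpos by simp
      then show ?thesis using 1 by (simp add: mult.assoc power_add[symmetric])
    next
      case 2
      have "(\<Prod>l=i+1..j. x) < (\<Prod>l=i+1..j. \<alpha> l)"
        using 2 j(1) xpos by (intro prod_mono_strict) (auto intro!: less_imp_le[OF above] above root_pos)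
      then have "x ^ (j - i) < (\<Prod>l=i+1..j. \<alpha> l)" by simp
      moreover have "polygon_coeff i = polygon_coeff j * (\<Prod>l=i+1..j. \<alpha> l)" using polygon_coeff_split[of i j] 2 j by simp
      ultimately have "polygon_coeff j * x ^ (j - i) * x ^ i < polygon_coeff i * x ^ i" using polygon_coeff_pos[OF j(1)] xpos by simp
      then show ?thesis using 2 by (simp add: mult.assoc power_add[symmetric])
    qed
    moreover have "a j * x ^ j \<le> polygon_coeff j * x ^ j" using coeff_le_polygon_coeff[OF j(1)] xpos by simp
    ultimately show False using j(2) by linarith
  qed
  then show ?thesis using j(2) xpos by simp
qed

text \<open>The index \<open>i\<close> is the left end of the edge of the Newton polygon that ends at or passes through \<open>m\<close>
  and whose slope belongs to the root \<open>\<alpha> m\<close>.\<close>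

lemma corner_below:
  assumes "m \<in> {1..d}"
  obtains i where "i < m" "a i = polygon_coeff i" "\<And>l. l \<in> {i+1..m} \<Longrightarrow> \<alpha> l = \<alpha> m"
proof (cases "\<exists>i. 1 \<le> i \<and> i < m \<and> \<alpha> i < \<alpha> m")
  case False
  have eq: "\<alpha> l = \<alpha> m" if "l \<in> {0+1..m}" for l
  proof (rule antisym)
    show "\<alpha> l \<le> \<alpha> m" using that root_mono[of l m] assms by simp
    show "\<alpha> m \<le> \<alpha> l"
    proof (rule ccontr)
      assume less: "\<not> \<alpha> m \<le> \<alpha> l"
      then have "l \<noteq> m" by blast
      with that have "l < m" by simp
      then show False using less that False by (auto simp: not_le)
    qed
  qed
  show thesis using assms by (intro that[of 0] coeff_0_attained eq) auto
next
  case True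
  define i where "i = (GREATEST i. 1 \<le> i \<and> i < m \<and> \<alpha> i < \<alpha> m)"
  have i: "1 \<le> i \<and> i < m \<and> \<alpha> i < \<alpha> m"
    unfolding i_def by (rule GreatestI_ex_nat[OF True, of m]) auto
  have max: "l \<le> i" if "1 \<le> l" "l < m" "\<alpha> l < \<alpha> m" for l
    unfolding i_def by (rule Greatest_le_nat[of _ _ m]) (use that in auto)
  have eq: "\<alpha> l = \<alpha> m" if "l \<in> {i+1..m}" for l
  proof (rule antisym)
    show "\<alpha> l \<le> \<alpha> m" using that root_mono[of l m] assms by simp
    show "\<alpha> m \<le> \<alpha> l" using that max[of l] by (cases "l = m") force+
  qed
  have "\<alpha> (i + 1) = \<alpha> m" using i by (intro eq) simp
  then show thesis using i assms by (intro that[of i] corner_attained eq) auto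
qed

lemma corner_above:
  assumes "m \<in> {1..d}"
  obtains i where "m \<le> i" "i \<le> d" "a i = polygon_coeff i" "\<And>l. l \<in> {m..i} \<Longrightarrow> \<alpha> l = \<alpha> m"
proof (cases "\<exists>i. m < i \<and> i \<le> d \<and> \<alpha> m < \<alpha> i")
  case False
  have eq: "\<alpha> l = \<alpha> m" if "l \<in> {m..d}" for l
  proof (rule antisym)
    show "\<alpha> m \<le> \<alpha> l" using that root_mono[of m l] assms by simp
    show "\<alpha> l \<le> \<alpha> m"
    proof (rule ccontr)
      assume less: "\<not> \<alpha> l \<le> \<alpha> m"
      then have "l \<noteq> m" by blast
      with that have "m < l" by simp
      then show False using less that False by (auto simp: not_le)
    qed
  qed
  show thesis using assms by (intro that[of d] coeff_d_attained[symmetric] eq) auto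
next
  case True
  define i where "i = (LEAST i. m < i \<and> i \<le> d \<and> \<alpha> m < \<alpha> i)"
  have i: "m < i \<and> i \<le> d \<and> \<alpha> m < \<alpha> i" unfolding i_def by (rule LeastI_ex[OF True])
  have min: "i \<le> l" if "m < l" "l \<le> d" "\<alpha> m < \<alpha> l" for l
    unfolding i_def by (rule Least_le) (use that in auto)
  have eq: "\<alpha> l = \<alpha> m" if "l \<in> {m..i-1}" for l
  proof (rule antisym)
    show "\<alpha> m \<le> \<alpha> l" by (rule root_mono) (use that assms i in auto)
    show "\<alpha> l \<le> \<alpha> m" using that min[of l] i by (cases "l = m") force+
  qed
  have "\<alpha> (i - 1) = \<alpha> m" using i by (intro eq) auto
  then show thesis using i assms by (intro that[of "i - 1"] corner_attained eq) auto
qed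

text \<open>The logarithm of the tropical polynomial at \<open>x\<close> provides an affine, hence concave, majorant of
  slope \<open>- ln x\<close>. It touches the points of indices \<open>i\<close> and \<open>i'\<close>, so between these indices no
  concave majorant can lie below it.\<close>

lemma newton_polygon_affine:
  assumes "i \<le> d" "i' \<le> d" "0 < x" "a i = polygon_coeff i" "a i' = polygon_coeff i'"
    and "tropical_poly d a x = polygon_coeff i * x ^ i" "tropical_poly d a x = polygon_coeff i' * x ^ i'"
    and y: "real i \<le> y" "y \<le> real i'"
  shows "newton_polygon d a y = ln (tropical_poly d a x) - y * ln x"
proof -
  let ?T = "tropical_poly d a x"
  define L where "L = (\<lambda>y. ln ?T - y * ln x)"
  have Tpos: "?T > 0" unfolding assms(6) using polygon_coeff_pos[OF assms(1)] assms(3) by simp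
  have val: "ln (a l) = L (real l)" if "a l = polygon_coeff l" "?T = polygon_coeff l * x ^ l" "l \<le> d" for l
    unfolding L_def that(1) that(2) using polygon_coeff_pos[OF that(3)] assms(3) by (simp add: ln_mult ln_realpow)
  show ?thesis
    unfolding newton_polygon_def
  proof (rule cInf_eq_minimum)
    have "concave_on {0..real d} L"
      unfolding concave_on_iff L_def
    proof (intro conjI ballI allI impI)
      fix s t u v :: real assume "u + v = 1"
      then have v: "v = 1 - u" by simp
      show "u * (ln ?T - s * ln x) + v * (ln ?T - t * ln x) \<le> ln ?T - (u *\<^sub>R s + v *\<^sub>R t) * ln x"
        unfolding v by (simp add: algebra_simps)
    qed simp
    moreover have "ln (a j) \<le> L (real j)" if "j \<le> d" "a j \<noteq> 0" for j
    proof -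
      have apos: "0 < a j" using that a_nonneg[of j] by simp
      have "ln (a j * x ^ j) \<le> ln ?T"
        using term_le[OF that(1), of x] apos assms(3) Tpos by simp
      then show ?thesis using apos assms(3) by (simp add: L_def ln_mult ln_realpow)
    qed
    ultimately show "ln ?T - y * ln x \<in> {g y |g. concave_on {0..real d} g \<and>
        (\<forall>j\<le>d. a j \<noteq> 0 \<longrightarrow> ln (a j) \<le> g (real j))}"
      by (intro CollectI exI[of _ L]) (auto simp: L_def)
  next
    fix z assume "z \<in> {g y |g. concave_on {0..real d} g \<and>
        (\<forall>j\<le>d. a j \<noteq> 0 \<longrightarrow> ln (a j) \<le> g (real j))}"
    then obtain g where g: "z = g y" "concave_on {0..real d} g"
      "\<And>j. j \<le> d \<Longrightarrow> a j \<noteq> 0 \<Longrightarrow> ln (a j) \<le> g (real j)" by blast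
    have gi: "L (real i) \<le> g (real i)" "L (real i') \<le> g (real i')"
      using g(3)[of i] g(3)[of i'] val[of i] val[of i'] assms polygon_coeff_pos[of i] polygon_coeff_pos[of i'] by auto
    show "ln ?T - y * ln x \<le> z"
    proof (cases "i = i'")
      case True
      then have "y = real i" using y by simp
      then show ?thesis using gi(1) by (simp add: g(1) L_def)
    next
      case False
      then have lt: "real i < real i'" using y by simp
      define u where "u = (real i' - y) / (real i' - real i)"
      define v where "v = (y - real i) / (real i' - real i)"
      have "u + v = ((real i' - y) + (y - real i)) / (real i' - real i)"
        unfolding u_def v_def by (rule add_divide_distrib[symmetric])
      then have uv: "0 \<le> u" "0 \<le> v" "u + v = 1" using y lt by (auto simp: u_def v_def)
      have "(real i' - real i) * (u * real i + v * real i')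
          = (real i' - y) * real i + (y - real i) * real i'"
        using lt by (simp add: u_def v_def distrib_left)
      also have "\<dots> = (real i' - real i) * y" by (simp add: algebra_simps)
      finally have yeq: "u * real i + v * real i' = y" using lt by simp
      have v: "v = 1 - u" using uv by simp
      have "ln ?T - y * ln x = u * L (real i) + v * L (real i')"
        unfolding yeq[symmetric] L_def v by (simp add: algebra_simps)
      also have "\<dots> \<le> u * g (real i) + v * g (real i')"
        using gi uv by (intro add_mono mult_left_mono) auto
      also have "\<dots> \<le> g (u *\<^sub>R real i + v *\<^sub>R real i')"
        using g(2) uv assms(1,2) unfolding concave_on_iff by auto
      finally show ?thesis using yeq g(1) by simp
    qed
  qed
qed

text \<open>The coefficient equals \<open>polygon_coeff\<close> at the endpoints and at the corners. An index whose
  coefficient is smaller lies strictly inside an edge, where the polygon is affine, so that the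
  slope does not change there.\<close>

theorem vertex_attained:
  assumes "real m \<in> newton_vertices d a"
  shows "a m = polygon_coeff m"
proof (cases "m = 0 \<or> m = d")
  case True
  then show ?thesis using coeff_0_attained coeff_d_attained by auto
next
  case False
  then have m: "0 < m" "m < d" and sl: "slope_changes_at (newton_polygon d a) (real m)"
    using assms unfolding newton_vertices_def by auto
  show ?thesis
  proof (rule ccontr)
    assume ne: "a m \<noteq> polygon_coeff m"
    let ?x = "\<alpha> m"
    have xpos: "0 < ?x" using root_pos m by simp
    obtain i where i: "i < m" "a i = polygon_coeff i" "\<And>l. l \<in> {i+1..m} \<Longrightarrow> \<alpha> l = ?x"
      using corner_below[of m] m by auto
    obtain i' where i': "m \<le> i'" "i' \<le> d" "a i' = polygon_coeff i'" "\<And>l. l \<in> {m..i'} \<Longrightarrow> \<alpha> l = ?x"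
      using corner_above[of m] m by auto
    have "m < i'" using i'(1,3) ne by (cases "m = i'") auto
    have "tropical_poly d a ?x = polygon_coeff i * ?x ^ i"
    proof (rule tropical_poly_between)
      show "?x \<le> \<alpha> l" if "l \<in> {i+1..d}" for l
      proof (cases "l \<le> m")
        case True
        then have "\<alpha> l = ?x" using that by (intro i(3)) simp
        then show ?thesis by simp
      qed (use that root_mono[of m l] m in simp)
    qed (use i(1) m xpos in \<open>auto intro!: root_mono\<close>)
    moreover have "tropical_poly d a ?x = polygon_coeff i' * ?x ^ i'"
    proof (rule tropical_poly_between)
      show "\<alpha> l \<le> ?x" if "l \<in> {1..i'}" for l
      proof (cases "m \<le> l")
        case True
        then have "\<alpha> l = ?x" using that by (intro i'(4)) simp
        then show ?thesis by simp
      qed (use that root_mono[of l m] m in simp)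
    qed (use i'(1-2) m xpos in \<open>auto intro!: root_mono\<close>)
    ultimately have affine: "newton_polygon d a y = ln (tropical_poly d a ?x) - y * ln ?x"
      if "real i \<le> y" "y \<le> real i'" for y
      using newton_polygon_affine[of i i' ?x y] that i(1,2) i'(1-3) m xpos by auto
    obtain s t e where ste: "e > 0" "s \<noteq> t"
      "\<And>h. h \<in> {0..e} \<Longrightarrow> newton_polygon d a (real m - h) = newton_polygon d a (real m) - s * h"
      "\<And>h. h \<in> {0..e} \<Longrightarrow> newton_polygon d a (real m + h) = newton_polygon d a (real m) + t * h"
      using sl unfolding slope_changes_at_def by blast
    define h where "h = min e 1"
    have h: "h \<in> {0..e}" "0 < h" "h \<le> 1" using ste(1) by (auto simp: h_def)
    have "newton_polygon d a (real m - h) = ln (tropical_poly d a ?x) - (real m - h) * ln ?x"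
      "newton_polygon d a (real m) = ln (tropical_poly d a ?x) - real m * ln ?x"
      "newton_polygon d a (real m + h) = ln (tropical_poly d a ?x) - (real m + h) * ln ?x"
      by (intro affine; use h i(1) \<open>m < i'\<close> in simp)+
    then have "s * h = - (h * ln ?x)" "t * h = - (h * ln ?x)"
      using ste(3,4)[OF h(1)] by (simp_all add: algebra_simps)
    then have "s * h = t * h" by simp
    then show False using h(2) ste(2) by simp
  qed
qed

end

context tropical
begin

lemma coeff_below_vertex:
  assumes "a m = polygon_coeff m" "m \<in> {1..d}" "l \<le> m"
  shows "a l \<le> a m * \<alpha> m ^ (m - l)"
proof -
  have "(\<Prod>i=l+1..m. \<alpha> i) \<le> (\<Prod>i=l+1..m. \<alpha> m)"
    using assms by (intro prod_mono) (auto intro!: root_nonneg root_mono)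
  moreover have "0 \<le> polygon_coeff m" using polygon_coeff_pos[of m] assms by simp
  ultimately have "polygon_coeff m * (\<Prod>i=l+1..m. \<alpha> i) \<le> polygon_coeff m * \<alpha> m ^ (m - l)"
    by (intro mult_left_mono) simp_all
  then show ?thesis
    using coeff_le_polygon_coeff[of l] polygon_coeff_split[of l m] assms by simp
qed

lemma coeff_above_vertex:
  assumes "a m = polygon_coeff m" "m < d" "m \<le> l" "l \<le> d"
  shows "a l * \<alpha> (m + 1) ^ (l - m) \<le> a m"
proof -
  have "(\<Prod>i=m+1..l. \<alpha> (m + 1)) \<le> (\<Prod>i=m+1..l. \<alpha> i)"
    using assms by (intro prod_mono) (auto intro!: root_nonneg root_mono)
  then have "a l * \<alpha> (m + 1) ^ (l - m) \<le> polygon_coeff l * (\<Prod>i=m+1..l. \<alpha> i)"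
    using assms coeff_le_polygon_coeff[of l] polygon_coeff_pos[of l] root_nonneg[of "m + 1"]
    by (intro mult_mono) simp_all
  then show ?thesis using polygon_coeff_split[of m l] assms by simp
qed

text \<open>Since the values of \<open>f\<close> have mean \<open>m\<close>, their total excess over \<open>m\<close> equals their total defect;
  call it \<open>s\<close>. Each unit of defect contributes at most a factor \<open>\<alpha> m\<close>, and each unit of excess at most
  a factor \<open>1 / \<alpha> (m + 1)\<close>. Together they give the ratio of the two roots to the power \<open>s\<close>; the ratio is
  at most \<open>1\<close>, and \<open>s \<ge> 1\<close> because \<open>f\<close> is not constantly \<open>m\<close> on \<open>I\<close>.\<close>

lemma prod_coeffs_le:
  assumes I: "finite I" and vertex: "a m = polygon_coeff m" "m \<in> {1..d}"
    and f: "\<And>i. i \<in> I \<Longrightarrow> f i \<le> d" "(\<Sum>i\<in>I. f i) = card I * m"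
    and nonconst: "\<exists>i\<in>I. f i \<noteq> m"
  shows "(\<Prod>i\<in>I. a (f i)) \<le> a m ^ card I * tropical_ratio d \<alpha> m"
proof -
  define s where "s = (\<Sum>i\<in>I. f i - m)"
  have "(\<Sum>i\<in>I. f i + (m - f i)) = (\<Sum>i\<in>I. m + (f i - m))" by (intro sum.cong) auto
  then have s': "(\<Sum>i\<in>I. m - f i) = s" using f(2) by (simp add: sum.distrib s_def)
  have "s \<noteq> 0"
  proof
    assume "s = 0"
    then have "f i \<le> m" "m \<le> f i" if "i \<in> I" for i
      using I that s' by (auto simp: s_def)
    then show False using nonconst by force
  qed
  then obtain i where "i \<in> I" "m < f i" using I by (auto simp: s_def)
  \<comment> \<open>In particular, for \<open>m = d\<close> there is no nonconstant choice at all.\<close>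
  then have md: "m < d" using f(1)[of i] by simp
  have pos: "0 < \<alpha> m" "0 < \<alpha> (m + 1)" using root_pos vertex md by auto
  define \<delta> where "\<delta> = \<alpha> m / \<alpha> (m + 1)"
  have \<delta>: "0 \<le> \<delta>" "\<delta> \<le> 1" using pos root_mono[of m "m + 1"] vertex md by (auto simp: \<delta>_def)
  have "a (f i) * \<alpha> (m + 1) ^ (f i - m) \<le> a m * \<alpha> m ^ (m - f i)" if "i \<in> I" for i
    using coeff_below_vertex[of m "f i"] coeff_above_vertex[of m "f i"] vertex md f(1)[OF that]
    by (cases "f i \<le> m") auto
  then have "(\<Prod>i\<in>I. a (f i) * \<alpha> (m + 1) ^ (f i - m)) \<le> (\<Prod>i\<in>I. a m * \<alpha> m ^ (m - f i))"
    using a_nonneg pos by (intro prod_mono) auto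
  then have "(\<Prod>i\<in>I. a (f i)) * \<alpha> (m + 1) ^ s \<le> a m ^ card I * \<alpha> m ^ s"
    by (simp add: prod.distrib power_sum[symmetric] s' s_def[symmetric])
  then have "(\<Prod>i\<in>I. a (f i)) \<le> a m ^ card I * \<delta> ^ s"
    using pos by (simp add: \<delta>_def power_divide pos_le_divide_eq)
  also have "\<dots> \<le> a m ^ card I * \<delta> ^ 1"
    using \<delta> \<open>s \<noteq> 0\<close> a_nonneg by (intro mult_left_mono power_decreasing) auto
  finally show ?thesis using md by (simp add: tropical_ratio_def \<delta>_def)
qed

end

section \<open>Coefficients of the determinant at the vertices\<close>

text \<open>Hadamard's inequality, with each column bounded by the norm of the matrix it is taken from.\<close>

lemma det_mixed_columns_le:
  fixes A :: "'i \<Rightarrow> complex^'n^'n"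
  assumes "is_matrix_norm N"
  shows "cmod (det (\<chi> r i. A (f i) $ r $ i)) \<le> columns_const N * (\<Prod>i\<in>UNIV. N (A (f i)))"
proof -
  have "cmod (det (\<chi> r i. A (f i) $ r $ i)) \<le> (\<Prod>i\<in>UNIV. norm (column i (\<chi> r i. A (f i) $ r $ i)))"
    by (rule hadamard_inequality_columns)
  also have "\<dots> = (\<Prod>i\<in>UNIV. norm (column i (A (f i))))" by (simp add: column_def)
  also have "\<dots> \<le> (\<Prod>i\<in>UNIV. column_const N i * N (A (f i)))"
    by (intro prod_mono conjI norm_ge_zero column_const_attained[OF assms])
  finally show ?thesis by (simp add: prod.distrib columns_const_def)
qed

text \<open>In the expansion of the coefficient, the constant choice \<open>f i = m\<close> contributes \<open>det (A m)\<close>, and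
  every other choice contributes at most an error proportional to the tropical ratio at the vertex.\<close>

lemma matpoly_det_coeff_vertex:
  fixes N :: "complex^'n^'n \<Rightarrow> real" and A :: "nat \<Rightarrow> complex^'n^'n"
  assumes N: "is_matrix_norm N" and trop: "tropical d (\<lambda>j. N (A j)) \<alpha>"
    and m: "m \<in> {1..d}" "real m \<in> newton_vertices d (\<lambda>j. N (A j))"
  shows "cmod (det (A m)) - (real (comp_count CARD('n) d (CARD('n) * m)) - 1) * columns_const N
      * tropical_ratio d \<alpha> m * N (A m) ^ CARD('n)
    \<le> cmod (coeff (det (matpoly d A)) (CARD('n) * m))"
proof -
  interpret tropical d "\<lambda>j. N (A j)" \<alpha> by (rule trop)
  let ?F = "{f :: 'n \<Rightarrow> nat. (\<forall>i. f i \<le> d) \<and> (\<Sum>i\<in>UNIV. f i) = CARD('n) * m}"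
  let ?G = "?F - {\<lambda>_. m}"
  let ?D = "\<lambda>f. det (\<chi> r i. A (f i) $ r $ i)"
  let ?B = "columns_const N * (N (A m) ^ CARD('n) * tropical_ratio d \<alpha> m)"
  have "finite (PiE (UNIV :: 'n set) (\<lambda>_. {..d}))" by (rule finite_PiE) auto
  then have fin: "finite ?F" by (rule rev_finite_subset) (auto simp: PiE_UNIV_domain)
  have const: "(\<lambda>_. m) \<in> ?F" using m by simp
  have "0 < card ?F" unfolding card_gt_0_iff using fin const by (metis (no_types, lifting) empty_iff)
  then have card: "real (card ?G) = real (comp_count CARD('n) d (CARD('n) * m)) - 1"
    using fin const card_functions_with_sum[where 'n = 'n, of d "CARD('n) * m"]
    by (simp add: card_Diff_singleton of_nat_diff)
  have "columns_const N > 0"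
    unfolding columns_const_def using column_const_attained(1)[OF N] by (intro prod_pos) auto
  then have "cmod (?D f) \<le> ?B" if "f \<in> ?G" for f
  proof -
    have "\<exists>i\<in>UNIV. f i \<noteq> m" using that by auto
    then have "(\<Prod>i\<in>UNIV. N (A (f i))) \<le> N (A m) ^ CARD('n) * tropical_ratio d \<alpha> m"
      using that m vertex_attained[OF m(2)] by (intro prod_coeffs_le) auto
    then show ?thesis
      using det_mixed_columns_le[OF N, of A f] \<open>columns_const N > 0\<close>
      by (meson mult_left_mono less_imp_le order_trans)
  qed
  then have "cmod (sum ?D ?G) \<le> card ?G * ?B"
    by (intro sum_norm_bound) auto
  moreover have "coeff (det (matpoly d A)) (CARD('n) * m) = det (A m) + sum ?D ?G"
    unfolding matpoly_det_coeff using sum.remove[OF fin const, of ?D] by simp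
  ultimately show ?thesis
    using norm_diff_ineq[of "det (A m)" "sum ?D ?G"] unfolding card by (simp add: mult.assoc mult.left_commute mult.commute)
qed

theorem theorem6p1:
  fixes N :: "complex^'n^'n \<Rightarrow> real"
    and A :: "nat \<Rightarrow> complex^'n^'n"
    and \<zeta> :: "nat \<Rightarrow> complex option"
    and \<alpha> :: "nat \<Rightarrow> real"
    and k :: "nat \<Rightarrow> nat"
    and d q :: nat
  assumes "d \<ge> 1"
    and "is_matrix_norm N"
    and "A d \<noteq> 0"
    and "det (A 0) \<noteq> 0"
    and "image_mset \<zeta> (mset_set {1..CARD('n) * d}) = eigenvalues d A"
    and "mono_on {1..CARD('n) * d} (\<lambda>i. modulus (\<zeta> i))"
    and "is_tropical_roots d (\<lambda>j. N (A j)) \<alpha>"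
    and "\<alpha> 0 = 0"
    and "strict_mono_on {0..q} k"
    and "k 0 = 0"
    and "k q = d"
    and "(\<lambda>j. real (k j)) ` {0..q} = newton_vertices d (\<lambda>j. N (A j))"
  shows "(\<forall>m\<le>CARD('n) * d.
            comp_count CARD('n) d m
              \<le> (min (min d m) (CARD('n) * d - m) + 1) ^ (CARD('n) - 1)) \<and>
         (\<forall>j\<in>{1..q}.
            let c = cmod (det (A 0)) / N (A 0) ^ CARD('n);
                \<delta> = tropical_ratio d \<alpha> (k j);
                cj = cmod (det (A (k j))) / N (A (k j)) ^ CARD('n)
                       - (real (comp_count CARD('n) d (CARD('n) * k j)) - 1) * columns_const N * \<delta>
            in cj > 0 \<longrightarrow>
               (\<Prod>i=1..CARD('n) * k j. modulus (\<zeta> i)) / ereal ((\<Prod>i=1..k j. \<alpha> i) ^ CARD('n))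
                 \<le> ereal (c / cj * real ((CARD('n) * d) choose (CARD('n) * k j))))"
proof (intro conjI allI impI ballI)
  fix m assume "m \<le> CARD('n) * d"
  then show "comp_count CARD('n) d m \<le> (min (min d m) (CARD('n) * d - m) + 1) ^ (CARD('n) - 1)"
    by (intro comp_count_le) (simp_all add: Suc_le_eq)
next
  fix j assume j: "j \<in> {1..q}"
  define n where "n = CARD('n)"
  define m where "m = k j"
  define \<delta> where "\<delta> = tropical_ratio d \<alpha> m"
  define c where "c = cmod (det (A 0)) / N (A 0) ^ n"
  define cj where "cj = cmod (det (A m)) / N (A m) ^ n
    - (real (comp_count n d (n * m)) - 1) * columns_const N * \<delta>"
  define binom where "binom = real ((n * d) choose (n * m))"
  define p where "p = det (matpoly d A)"
  define R where "R = (\<Prod>i=1..n*m. cmod (reciprocal (\<zeta> i)))"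
  define Q where "Q = (\<Prod>i=1..m. \<alpha> i)"
  have "0 < n" unfolding n_def by simp
  have N: "0 \<le> N X" "N X = 0 \<longleftrightarrow> X = 0" for X
    using assms(2) unfolding is_matrix_norm_def by blast+
  have "A 0 \<noteq> 0"
  proof
    assume "A 0 = 0"
    then have "row i (A 0) = 0" for i by (simp add: row_def vec_eq_iff)
    then show False using det_zero_row(2) assms(4) by blast
  qed
  interpret tropical d "\<lambda>j. N (A j)" \<alpha>
    by unfold_locales (use assms(3,7) N \<open>A 0 \<noteq> 0\<close> in auto)
  have "k 0 < k j" "k j \<le> k q"
    using j strict_mono_onD[OF assms(9), of 0 j] strict_mono_onD[OF assms(9), of j q]
    by (auto simp: le_less)
  then have m: "m \<in> {1..d}" using assms(10,11) unfolding m_def by simp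
  have vertex: "real m \<in> newton_vertices d (\<lambda>j. N (A j))"
    using assms(12) j unfolding m_def by auto
  have attained: "N (A m) = polygon_coeff m" by (rule vertex_attained[OF vertex])
  then have am: "0 < N (A m)" using polygon_coeff_pos[of m] m by simp
  have a0: "N (A 0) = N (A m) * Q"
    using coeff_0_attained polygon_coeff_split[of 0 m] m attained by (simp add: Q_def)
  have Q: "0 < Q" unfolding Q_def using m root_pos by (intro prod_pos) auto
  have "(\<Prod>i=1..n*m. modulus (\<zeta> i)) / ereal (Q ^ n) \<le> ereal (c / cj * binom)" if cj: "0 < cj"
  proof -
    have "cj * N (A m) ^ n = cmod (det (A m))
        - (real (comp_count n d (n * m)) - 1) * columns_const N * \<delta> * N (A m) ^ n"
      using am by (simp add: cj_def left_diff_distrib)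
    also have "\<dots> \<le> cmod (coeff p (n * m))"
      unfolding p_def n_def \<delta>_def
      by (rule matpoly_det_coeff_vertex[OF assms(2) tropical_axioms m vertex])
    also have "\<dots> \<le> cmod (coeff p 0) * binom * R"
      unfolding R_def binom_def
      by (rule norm_coeff_le_binomial[of p \<zeta> "n * d" "n * d - degree p"])
         (use assms(4-6) in \<open>simp_all add: p_def n_def matpoly_det_coeff_0 eigenvalues_def\<close>)
    also have "cmod (coeff p 0) = c * N (A 0) ^ n"
      using \<open>A 0 \<noteq> 0\<close> N(2) by (simp add: p_def c_def matpoly_det_coeff_0)
    finally have "cj * N (A m) ^ n \<le> (c * Q ^ n * binom * R) * N (A m) ^ n"
      by (simp add: a0 power_mult_distrib mult_ac)
    then have le: "cj \<le> c * Q ^ n * binom * R" using am by simp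
    \<comment> \<open>The lower bound on the coefficient forces the first \<open>n * m\<close> eigenvalues to be finite.\<close>
    then have "R \<noteq> 0" using cj by auto
    then have nz: "reciprocal (\<zeta> i) \<noteq> 0" if "i \<in> {1..n*m}" for i
      using that unfolding R_def by auto
    have R: "0 < R" using \<open>R \<noteq> 0\<close> prod_nonneg[of "{1..n*m}" "\<lambda>i. cmod (reciprocal (\<zeta> i))"]
      unfolding R_def by (simp add: less_le)
    have "(\<Prod>i=1..n*m. modulus (\<zeta> i)) = (\<Prod>i=1..n*m. ereal (inverse (cmod (reciprocal (\<zeta> i)))))"
    proof (rule prod.cong[OF refl])
      fix i assume "i \<in> {1..n*m}"
      from nz[OF this] show "modulus (\<zeta> i) = ereal (inverse (cmod (reciprocal (\<zeta> i))))"
        by (cases "\<zeta> i") (auto simp: norm_inverse)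
    qed
    also have "\<dots> = ereal (inverse R)"
      unfolding R_def prod_ereal prod_inversef[symmetric] by (simp add: comp_def)
    finally have "(\<Prod>i=1..n*m. modulus (\<zeta> i)) / ereal (Q ^ n) = ereal (inverse R / Q ^ n)"
      using Q by simp
    moreover have "inverse R / Q ^ n \<le> c / cj * binom"
      using le R Q cj by (simp add: field_simps)
    ultimately show ?thesis by simp
  qed
  then show "let c = cmod (det (A 0)) / N (A 0) ^ CARD('n);
                \<delta> = tropical_ratio d \<alpha> (k j);
                cj = cmod (det (A (k j))) / N (A (k j)) ^ CARD('n)
                       - (real (comp_count CARD('n) d (CARD('n) * k j)) - 1) * columns_const N * \<delta>
            in cj > 0 \<longrightarrow>
               (\<Prod>i=1..CARD('n) * k j. modulus (\<zeta> i)) / ereal ((\<Prod>i=1..k j. \<alpha> i) ^ CARD('n))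
                 \<le> ereal (c / cj * real ((CARD('n) * d) choose (CARD('n) * k j)))"
    unfolding Let_def cj_def c_def \<delta>_def Q_def binom_def n_def m_def by blast
qed

end
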